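(* Let $n\in\mathbb{N}$, let $F\in\mathbb{R}[x_1,\ldots,x_n]$ be a symmetric polynomial of degree $d$ and let $k:=\max\{2,\lfloor d/2\rfloor\}$. Then: (i) $F(x)\ge 0$ holds for all $x\in\mathbb{R}^n$ if and only if $F(x)\ge 0$ holds for all $x\in A_k$; (ii) $F(x)\ge 0$ holds for all $x\in\mathbb{R}^n_{+}$ if and only if $F(x)\ge 0$ holds for all $x\in A_k^{+}$.
   Context: A polynomial $F\in\mathbb{R}[x_1,\ldots,x_n]$ is symmetric if $F(x_{\sigma(1)},\ldots,x_{\sigma(n)})=F(x_1,\ldots,x_n)$ for every permutation $\sigma$ in the symmetric group $S_n$. $\mathbb{R}^n_{+}=\{x\in\mathbb{R}^n : x_i\ge 0 \text{ for all } i\}$. For $x\in\mathbb{R}^n$ let $n(x)=\#\{x_1,\ldots,x_n\}$ be the number of distinct components of $x$ and $n^{*}(x)=\#\{x_j : 1\le j\le n,\ x_j\neq 0\}$ the number of distinct non-zero components of $x$. For $k\in\mathbb{N}$, $A_k:=\{x\in\mathbb{R}^n : n(x)\le k\}$ and $A_k^{+}:=\{x\in\mathbb{R}^n_{+} : n^{*}(x)\le k\}$. *)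

theory Defs
  imports "HOL-Analysis.Analysis" "HOL-Library.Poly_Mapping" "HOL-Combinatorics.Permutations"
begin

text \<open>
  A monomial in the variables indexed by \<open>'n\<close> is its exponent function \<open>'n \<Rightarrow>\<^sub>0 nat\<close>; a polynomial
  is the finitely supported family of its coefficients. The library's ring structure on
  \<open>\<Rightarrow>\<^sub>0\<close> (convolution product) makes this type the polynomial ring
  \<open>\<real>[x\<^sub>i : i \<in> 'n]\<close>, with \<open>n = CARD('n)\<close>.
\<close>

type_synonym 'n rpoly = "('n \<Rightarrow>\<^sub>0 nat) \<Rightarrow>\<^sub>0 real"

definition eval_poly :: "'n::finite rpoly \<Rightarrow> real ^ 'n \<Rightarrow> real" where
  "eval_poly F x =
     (\<Sum>m\<in>Poly_Mapping.keys F. Poly_Mapping.lookup F m *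
        (\<Prod>i\<in>UNIV. (x $ i) ^ Poly_Mapping.lookup m i))"

text \<open>Total degree, with the convention that the zero polynomial has degree \<open>0\<close>.\<close>

definition total_degree :: "'n::finite rpoly \<Rightarrow> nat" where
  "total_degree F =
     Max (insert 0 ((\<lambda>m. \<Sum>i\<in>UNIV. Poly_Mapping.lookup m i) ` Poly_Mapping.keys F))"

text \<open>
  The polynomial \<open>F(x\<^bsub>\<sigma>(1)\<^esub>, \<dots>, x\<^bsub>\<sigma>(n)\<^esub>)\<close>. Substituting \<open>x\<^bsub>\<sigma>(i)\<^esub>\<close> for \<open>x\<^sub>i\<close> turns the monomial with
  exponents \<open>m \<circ> \<sigma>\<close> into the one with exponents \<open>m\<close>, so the coefficient at \<open>m\<close> is that of
  \<open>F\<close> at \<open>m \<circ> \<sigma>\<close>.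
\<close>

definition permute_vars :: "('n \<Rightarrow> 'n) \<Rightarrow> 'n::finite rpoly \<Rightarrow> 'n rpoly" where
  "permute_vars \<sigma> F = Poly_Mapping.map_key (Poly_Mapping.map_key \<sigma>) F"

definition symmetric_poly :: "'n::finite rpoly \<Rightarrow> bool" where
  "symmetric_poly F \<longleftrightarrow> (\<forall>\<sigma>. \<sigma> permutes UNIV \<longrightarrow> permute_vars \<sigma> F = F)"

definition nonneg_orthant :: "(real ^ 'n::finite) set" where
  "nonneg_orthant = {x. \<forall>i. 0 \<le> x $ i}"

definition num_distinct :: "real ^ 'n::finite \<Rightarrow> nat" where
  "num_distinct x = card {x $ j | j. True}"

definition num_distinct_nonzero :: "real ^ 'n::finite \<Rightarrow> nat" where
  "num_distinct_nonzero x = card {x $ j | j. x $ j \<noteq> 0}"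

definition A_set :: "nat \<Rightarrow> (real ^ 'n::finite) set" where
  "A_set k = {x. num_distinct x \<le> k}"

definition A_plus_set :: "nat \<Rightarrow> (real ^ 'n::finite) set" where
  "A_plus_set k = {x \<in> nonneg_orthant. num_distinct_nonzero x \<le> k}"

lemma lookup_permute_vars:
  fixes F :: "'n::finite rpoly"
  assumes "\<sigma> permutes UNIV"
  shows "Poly_Mapping.lookup (permute_vars \<sigma> F) m =
         Poly_Mapping.lookup F (Poly_Mapping.map_key \<sigma> m)"
    and "inj (Poly_Mapping.map_key \<sigma> :: ('n \<Rightarrow>\<^sub>0 nat) \<Rightarrow> _)"
    and "surj (Poly_Mapping.map_key \<sigma> :: ('n \<Rightarrow>\<^sub>0 nat) \<Rightarrow> _)"
proof -
  have s: "inj \<sigma>" and s': "inj (inv \<sigma>)"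
    using assms permutes_inv permutes_inj by blast+
  have 1: "Poly_Mapping.map_key (inv \<sigma>) (Poly_Mapping.map_key \<sigma> p) = p" for p :: "'n \<Rightarrow>\<^sub>0 nat"
    by (rule poly_mapping_eqI) (simp add: map_key.rep_eq s s' permutes_inverses[OF assms])
  have 2: "Poly_Mapping.map_key \<sigma> (Poly_Mapping.map_key (inv \<sigma>) p) = p" for p :: "'n \<Rightarrow>\<^sub>0 nat"
    by (rule poly_mapping_eqI) (simp add: map_key.rep_eq s s' permutes_inverses[OF assms])
  show i: "inj (Poly_Mapping.map_key \<sigma> :: ('n \<Rightarrow>\<^sub>0 nat) \<Rightarrow> _)"
    by (rule injI) (metis 1)
  show "surj (Poly_Mapping.map_key \<sigma> :: ('n \<Rightarrow>\<^sub>0 nat) \<Rightarrow> _)"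
    by (metis 2 surj_def)
  show "Poly_Mapping.lookup (permute_vars \<sigma> F) m =
         Poly_Mapping.lookup F (Poly_Mapping.map_key \<sigma> m)"
    by (simp add: permute_vars_def map_key.rep_eq i)
qed

lemma eval_permute_vars:
  fixes F :: "'n::finite rpoly"
  assumes "\<sigma> permutes UNIV"
  shows "eval_poly (permute_vars \<sigma> F) x = eval_poly F (\<chi> i. x $ \<sigma> i)"
proof -
  let ?h = "Poly_Mapping.map_key \<sigma> :: ('n \<Rightarrow>\<^sub>0 nat) \<Rightarrow> _"
  have s: "inj \<sigma>" using assms permutes_inj by blast
  have b: "bij \<sigma>" using assms permutes_bij by blast
  note L = lookup_permute_vars[OF assms]
  have "bij_betw ?h (Poly_Mapping.keys (permute_vars \<sigma> F)) (Poly_Mapping.keys F)"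
  proof (rule bij_betw_imageI)
    show "inj_on ?h (Poly_Mapping.keys (permute_vars \<sigma> F))"
      using L(2) by (rule inj_on_subset) simp
    show "?h ` Poly_Mapping.keys (permute_vars \<sigma> F) = Poly_Mapping.keys F"
    proof (intro equalityI subsetI)
      fix m assume "m \<in> Poly_Mapping.keys F"
      moreover obtain m' where "m = ?h m'" using L(3) by (metis surjD)
      ultimately show "m \<in> ?h ` Poly_Mapping.keys (permute_vars \<sigma> F)"
        by (auto simp: in_keys_iff L(1))
    qed (auto simp: in_keys_iff L(1))
  qed
  then have "eval_poly F (\<chi> i. x $ \<sigma> i) =
    (\<Sum>m\<in>Poly_Mapping.keys (permute_vars \<sigma> F). Poly_Mapping.lookup F (?h m) *
        (\<Prod>i\<in>UNIV. (x $ \<sigma> i) ^ Poly_Mapping.lookup (?h m) i))"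
    unfolding eval_poly_def by (subst sum.reindex_bij_betw[symmetric]) simp_all
  also have "\<dots> = eval_poly (permute_vars \<sigma> F) x"
    unfolding eval_poly_def
  proof (rule sum.cong, simp)
    fix m :: "'n \<Rightarrow>\<^sub>0 nat"
    have "(\<Prod>i\<in>UNIV. (x $ \<sigma> i) ^ Poly_Mapping.lookup (?h m) i) =
          (\<Prod>i\<in>UNIV. (x $ i) ^ Poly_Mapping.lookup m i)"
      using prod.reindex_bij_betw[OF b, of "\<lambda>i. (x $ i) ^ Poly_Mapping.lookup m i"]
      by (simp add: map_key.rep_eq s)
    then show "Poly_Mapping.lookup F (?h m) *
          (\<Prod>i\<in>UNIV. (x $ \<sigma> i) ^ Poly_Mapping.lookup (?h m) i) =
        Poly_Mapping.lookup (permute_vars \<sigma> F) m * (\<Prod>i\<in>UNIV. (x $ i) ^ Poly_Mapping.lookup m i)"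
      by (simp add: L(1))
  qed
  finally show ?thesis by simp
qed

end

theory Submission
  imports Defs
begin

text \<open>
  Suppose \<open>y\<close> has more than \<open>k\<close> distinct (for the orthant: distinct non-zero) values. Choose one
  coordinate for each of these values \<open>t\<^sub>1, \<dots>, t\<^sub>m\<close> and replace them by the roots of
  \<open>(X - t\<^sub>1) \<cdots> (X - t\<^sub>m) + s\<close>, which are real for small \<open>s\<close> of either sign. The power sums of degree
  less than \<open>m\<close> do not change and those of degree less than \<open>2m\<close> are affine in \<open>s\<close>. A symmetric
  polynomial of degree at most \<open>2k + 1\<close> is a combination of products of power sums with at most one
  factor of degree above \<open>k\<close>, so it is affine in \<open>s\<close> as well.

  Now minimise \<open>F\<close> on the compact set with prescribed power sums of degree at most \<open>k\<close>, and among the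
  minimisers maximise \<open>\<Prod>\<^sub>i (t - y\<^sub>i)\<close> for a fixed large \<open>t\<close>. At such a \<open>y\<close> the affine function
  \<open>F\<close> of \<open>s\<close> is constant, whereas the product strictly increases with \<open>s\<close>; hence \<open>y\<close> has at most
  \<open>k\<close> distinct values.
\<close>

section \<open>Power sums under a constant shift of a product of linear factors\<close>

text \<open>Newton's identities in generating-function form: the logarithmic derivative of
  \<open>1 - y i * X\<close> is \<open>- y i\<close> times a geometric series, and summing over
  \<open>J\<close> gives minus the series of power sums, which starts at exponent 1.\<close>

lemma fps_deriv_prod_linear_factors:
  fixes y :: "'a \<Rightarrow> 'b::field"
  assumes "finite J"
  defines "N \<equiv> Abs_fps (\<lambda>r. \<Sum>i\<in>J. y i ^ Suc r)"
  shows "fps_deriv (\<Prod>i\<in>J. 1 - fps_const (y i) * fps_X) = - (\<Prod>i\<in>J. 1 - fps_const (y i) * fps_X) * N"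
  using assms(1) unfolding N_def
proof (induction J)
  case empty
  show ?case by (simp add: fps_zero_def)
next
  case (insert j J)
  let ?A = "\<Prod>i\<in>J. 1 - fps_const (y i) * fps_X"
  let ?L = "1 - fps_const (y j) * fps_X"
  let ?N = "\<lambda>J. Abs_fps (\<lambda>r. \<Sum>i\<in>J. y i ^ Suc r)"
  \<comment> \<open>The geometric series, which inverts the new factor \<open>?L\<close>.\<close>
  define G where "G = Abs_fps (\<lambda>r. y j ^ r)"
  have G: "?L * G = 1"
    by (rule fps_ext) (auto simp: G_def algebra_simps mult.assoc fps_X_mult_nth simp flip: power_Suc)
  have N: "?N (insert j J) = ?N J + fps_const (y j) * G"
    using insert by (intro fps_ext) (simp add: G_def)
  have "- (?L * ?A) * (?N J + fps_const (y j) * G) = - (?A * ?N J) * ?L - ?A * fps_const (y j) * (?L * G)"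
    by (simp add: algebra_simps)
  then show ?case
    using insert by (simp only: N G prod.insert fps_deriv_mult) (simp add: algebra_simps)
qed

text \<open>Substituting \<open>1 / x\<close> and multiplying by \<open>x ^ card J\<close> reverses
  the coefficients, so the constant shift moves to the top coefficient. At \<open>x = 0\<close> both
  sides are 1 because \<open>J\<close> is nonempty.\<close>

lemma prod_shift_reversed:
  fixes t y :: "'a \<Rightarrow> real"
  assumes "finite J" "J \<noteq> {}" "\<And>x. (\<Prod>i\<in>J. x - y i) = (\<Prod>i\<in>J. x - t i) + s"
  shows "(\<Prod>i\<in>J. 1 - fps_const (y i) * fps_X) =
    (\<Prod>i\<in>J. 1 - fps_const (t i) * fps_X) + fps_const s * fps_X ^ card J"
proof -
  have rev: "(\<Prod>i\<in>J. 1 - u i * x) = x ^ card J * (\<Prod>i\<in>J. 1 / x - u i)" if "x \<noteq> 0" for u and x :: real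
  proof -
    have "(\<Prod>i\<in>J. 1 - u i * x) = (\<Prod>i\<in>J. x * (1 / x - u i))"
      using that by (intro prod.cong) (auto simp: field_simps)
    then show ?thesis by (simp add: prod.distrib)
  qed
  have "(\<Prod>i\<in>J. 1 - y i * x) = (\<Prod>i\<in>J. 1 - t i * x) + s * x ^ card J" for x
  proof (cases "x = 0")
    case False
    then show ?thesis by (simp add: rev assms(3)) (simp add: algebra_simps)
  qed (use assms in auto)
  then have "poly (\<Prod>i\<in>J. [:1, - y i:]) = poly ((\<Prod>i\<in>J. [:1, - t i:]) + monom s (card J))"
    by (intro ext) (simp add: poly_prod poly_monom algebra_simps)
  then have "fps_of_poly (\<Prod>i\<in>J. [:1, - y i:]) = fps_of_poly ((\<Prod>i\<in>J. [:1, - t i:]) + monom s (card J))"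
    by (simp only: poly_eq_poly_eq_iff)
  moreover have "fps_of_poly [:1, - c:] = 1 - fps_const c * fps_X" for c :: real
    by (simp add: fps_of_poly_pCons flip: fps_const_neg)
  ultimately show ?thesis
    by (simp add: fps_of_poly_prod fps_of_poly_add fps_of_poly_monom)
qed

text \<open>Comparing Newton's identities for \<open>y\<close> and \<open>t\<close> determines the
  change of the power sums up to an error quadratic in \<open>s\<close>, and that error first
  appears at exponent \<open>2 * card J\<close>.\<close>

lemma power_sum_shift:
  fixes t :: "'a \<Rightarrow> real"
  assumes "finite J" "J \<noteq> {}"
  shows "\<exists>c. (\<forall>r<card J. c r = 0) \<and>
    (\<forall>y s. (\<forall>x. (\<Prod>i\<in>J. x - y i) = (\<Prod>i\<in>J. x - t i) + s) \<longrightarrow>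
      (\<forall>r<2 * card J. (\<Sum>i\<in>J. y i ^ r) = (\<Sum>i\<in>J. t i ^ r) + c r * s))"
proof -
  define m where "m = card J - 1"
  have m: "card J = Suc m"
    using assms by (simp add: m_def card_gt_0_iff Suc_diff_1)
  let ?A = "\<lambda>y. \<Prod>i\<in>J. 1 - fps_const (y i) * fps_X :: real fps"
  let ?N = "\<lambda>y. Abs_fps (\<lambda>r. \<Sum>i\<in>J. y i ^ Suc r) :: real fps"
  have "fps_nth (?A t) 0 = 1"
    using assms(1) by (induction J rule: finite_induct) simp_all
  then have inv: "inverse (?A t) * ?A t = 1"
    by (intro inverse_mult_eq_1) simp
  \<comment> \<open>Up to the factor \<open>- s\<close>, the linear part of the change in the power
    sum series; it is divisible by \<open>fps_X ^ m\<close>.\<close>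
  define E where "E = fps_X ^ m * (inverse (?A t) * (of_nat (Suc m) + fps_X * ?N t))"
  \<comment> \<open>Indices shift by one because coefficient \<open>r'\<close> of the series is the
    power sum of exponent \<open>Suc r'\<close>; exponent 0 just counts \<open>J\<close> and never
    changes.\<close>
  define c where "c = (\<lambda>r. case r of 0 \<Rightarrow> 0 | Suc r' \<Rightarrow> - fps_nth E r')"
  show ?thesis
  proof (intro exI[of _ c] conjI allI impI)
    show "c r = 0" if "r < card J" for r
      using that m by (auto simp: c_def E_def fps_X_power_mult_nth split: nat.split)
  next
    fix y s r
    assume y: "\<forall>x. (\<Prod>i\<in>J. x - y i) = (\<Prod>i\<in>J. x - t i) + s" and r: "r < 2 * card J"
    define A N N' X n \<sigma> where defs: "A = ?A t" "N = ?N t" "N' = ?N y" "X = (fps_X ^ m :: real fps)"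
      "n = (of_nat (Suc m) :: real fps)" "\<sigma> = fps_const s"
    define B where "B = N' - N"
    have E: "E = X * (inverse A * (n + fps_X * N))"
      by (simp only: E_def defs)
    have AI: "inverse A * A = 1"
      using inv by (simp only: defs)
    have d: "fps_deriv (\<sigma> * (fps_X * X)) = \<sigma> * n * X"
      unfolding defs power_Suc[symmetric] by (simp add: fps_deriv_power fps_of_nat del: power_Suc of_nat_Suc)
    have "?A y = A + \<sigma> * (fps_X * X)"
      using prod_shift_reversed[OF assms y[rule_format]] m by (simp add: defs)
    then have "- (A + \<sigma> * (fps_X * X)) * N' = - A * N + \<sigma> * n * X"
      using fps_deriv_prod_linear_factors[OF assms(1), of y] fps_deriv_prod_linear_factors[OF assms(1), of t]
      by (metis d defs(1-3) fps_deriv_add)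
    \<comment> \<open>\<open>N'\<close> still contains the unknown change \<open>B\<close>, but this
      equation already shows that \<open>X\<close> divides \<open>B\<close>.\<close>
    then have "A * B = - \<sigma> * X * (n + fps_X * N')"
      unfolding B_def by algebra
    then have B: "B = X * (- \<sigma> * inverse A * (n + fps_X * N'))"
      using AI by algebra
    then obtain U where U: "B = X * U"
      by blast
    \<comment> \<open>Replacing \<open>N'\<close> by \<open>N + X * U\<close> pushes everything
      nonlinear in \<open>s\<close> to order \<open>2 * m + 1\<close> and beyond.\<close>
    have "B = - \<sigma> * E - (fps_X * X * X) * (\<sigma> * inverse A * U)"
      using B U E B_def by algebra
    also have "fps_X * X * X = fps_X ^ (Suc m + m)"
      by (simp add: defs power_add)
    finally have "fps_nth B r' = - s * fps_nth E r'" if "r' < Suc m + m" for r'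
      using that by (auto simp: fps_X_power_mult_nth defs(6) mult.assoc)
    then show "(\<Sum>i\<in>J. y i ^ r) = (\<Sum>i\<in>J. t i ^ r) + c r * s"
      using r m by (cases r) (auto simp: c_def B_def defs algebra_simps)
  qed
qed

section \<open>Real roots of the shifted product\<close>

text \<open>The product changes sign across each \<open>t i\<close>, and a small shift preserves the
  signs at the ends of disjoint intervals around the \<open>t i\<close>. The intermediate value
  theorem then yields \<open>card J\<close> distinct roots, which is all of them.\<close>

lemma shifted_prod_roots:
  fixes t :: "'a \<Rightarrow> real"
  assumes J: "finite J" "J \<noteq> {}" and inj: "inj_on t J" and "\<eta> > 0"
  shows "\<exists>\<epsilon>>0. \<forall>s. \<bar>s\<bar> < \<epsilon> \<longrightarrow>
    (\<exists>y. (\<forall>i\<in>J. \<bar>y i - t i\<bar> < \<eta>) \<and> (\<forall>x. (\<Prod>i\<in>J. x - y i) = (\<Prod>i\<in>J. x - t i) + s))"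
proof -
  \<comment> \<open>A third of the minimum keeps the intervals disjoint; including
    \<open>\<eta>\<close> makes them small enough and the set nonempty.\<close>
  define D where "D = insert \<eta> ((\<lambda>(i, j). \<bar>t i - t j\<bar>) ` (J \<times> J - Id))"
  have finD: "finite D"
    using J by (simp add: D_def)
  have "\<forall>x\<in>D. x > 0"
    using \<open>\<eta> > 0\<close> by (auto simp: D_def dest: inj_onD[OF inj])
  then have MinD: "Min D > 0"
    using finD by (subst Min_gr_iff) (auto simp: D_def)
  define \<delta> where "\<delta> = Min D / 3"
  have \<delta>: "\<delta> > 0" and \<delta>\<eta>: "\<delta> < \<eta>"
    using MinD Min_le[OF finD, of \<eta>] by (auto simp: \<delta>_def D_def)
  have sep: "2 * \<delta> < \<bar>t i - t j\<bar>" if "i \<in> J" "j \<in> J" "i \<noteq> j" for i j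
  proof -
    have "\<bar>t i - t j\<bar> \<in> D" using that by (auto simp: D_def)
    then show ?thesis using MinD Min_le[OF finD] by (force simp: \<delta>_def)
  qed
  define p where "p = (\<lambda>x. \<Prod>i\<in>J. x - t i)"
  have sign: "p (t i - \<delta>) * p (t i + \<delta>) < 0" if "i \<in> J" for i
  proof -
    have "p (t i - \<delta>) * p (t i + \<delta>) = (\<Prod>j\<in>J. (t i - t j)\<^sup>2 - \<delta>\<^sup>2)"
      unfolding p_def prod.distrib[symmetric]
      by (intro prod.cong) (auto simp: algebra_simps power2_eq_square)
    \<comment> \<open>Only the factor with \<open>j = i\<close> is negative, as the other points are
      farther than \<open>\<delta>\<close> from \<open>t i\<close>.\<close>
    also have "\<dots> = - \<delta>\<^sup>2 * (\<Prod>j\<in>J - {i}. (t i - t j)\<^sup>2 - \<delta>\<^sup>2)"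
      using that J by (simp add: prod.remove)
    also have "\<dots> < 0"
    proof -
      have "0 < (t i - t j)\<^sup>2 - \<delta>\<^sup>2" if "j \<in> J - {i}" for j
        using sep[of i j] that \<open>i \<in> J\<close> \<delta> power_strict_mono[of \<delta> "\<bar>t i - t j\<bar>" 2] by auto
      then have "(\<Prod>j\<in>J - {i}. (t i - t j)\<^sup>2 - \<delta>\<^sup>2) > 0" by (intro prod_pos) auto
      then show ?thesis using \<delta> by (simp add: mult_neg_pos)
    qed
    finally show ?thesis .
  qed
  \<comment> \<open>A shift smaller than all these endpoint values cannot alter a sign
    there.\<close>
  define E where "E = (\<lambda>i. \<bar>p (t i - \<delta>)\<bar>) ` J \<union> (\<lambda>i. \<bar>p (t i + \<delta>)\<bar>) ` J"
  have finE: "finite E" "E \<noteq> {}" using J by (auto simp: E_def)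
  have Epos: "\<forall>x\<in>E. x > 0"
    using sign by (fastforce simp: E_def)
  show ?thesis
  proof (intro exI[of _ "Min E"] conjI allI impI)
    show "Min E > 0" using Epos finE by simp
    fix s assume s: "\<bar>s\<bar> < Min E"
    have "\<exists>z. \<bar>z - t i\<bar> \<le> \<delta> \<and> p z + s = 0" if iJ: "i \<in> J" for i
    proof -
      have "\<bar>s\<bar> < \<bar>p (t i - \<delta>)\<bar>" "\<bar>s\<bar> < \<bar>p (t i + \<delta>)\<bar>"
        using s finE that by (auto simp: E_def)
      moreover have "continuous_on S (\<lambda>x. p x + s)" for S
        unfolding p_def by (intro continuous_intros)
      moreover consider "p (t i - \<delta>) < 0" "p (t i + \<delta>) > 0" | "p (t i - \<delta>) > 0" "p (t i + \<delta>) < 0"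
        using sign[OF iJ] by (auto simp: mult_less_0_iff)
      ultimately have "\<exists>z. t i - \<delta> \<le> z \<and> z \<le> t i + \<delta> \<and> p z + s = 0"
        using \<delta> IVT'[of "\<lambda>x. p x + s" "t i - \<delta>" 0 "t i + \<delta>"]
          IVT2'[of "\<lambda>x. p x + s" "t i + \<delta>" 0 "t i - \<delta>"] by (smt (verit))
      then show ?thesis unfolding abs_diff_le_iff by blast
    qed
    then obtain y where y: "\<And>i. i \<in> J \<Longrightarrow> \<bar>y i - t i\<bar> \<le> \<delta> \<and> p (y i) + s = 0" by metis
    have injy: "inj_on y J"
    proof (rule inj_onI, rule ccontr)
      fix i j assume "i \<in> J" "j \<in> J" "y i = y j" "i \<noteq> j"
      then show False using sep[of i j] y[of i] y[of j] by linarith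
    qed
    let ?P = "\<lambda>u. \<Prod>i\<in>J. [:- u i, 1:]"
    have monic: "degree (?P u) = card J" "coeff (?P u) (card J) = 1" for u :: "'a \<Rightarrow> real"
    proof -
      show "degree (?P u) = card J" by (subst degree_prod_eq_sum_degree) auto
      then show "coeff (?P u) (card J) = 1"
        using lead_coeff_prod[of "\<lambda>i. [:- u i, 1:]" J] by simp
    qed
    \<comment> \<open>Both sides are monic of degree \<open>card J\<close> and agree at
      \<open>card J\<close> points; since \<open>card J > 0\<close>, the constant \<open>s\<close>
      leaves the leading coefficient alone.\<close>
    have "?P y = ?P t + [:s:]"
    proof (rule poly_eqI_degree_lead_coeff[where A = "y ` J"])
      have "card J > 0" using J by (simp add: card_gt_0_iff)
      then show "coeff (?P y) (card J) = coeff (?P t + [:s:]) (card J)"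
        by (simp add: monic coeff_pCons split: nat.split)
      show "degree (?P t + [:s:]) \<le> card J"
        by (intro degree_add_le) (auto simp: monic)
      show "card J \<le> card (y ` J)" "degree (?P y) \<le> card J"
        by (simp_all add: card_image[OF injy] monic)
      show "poly (?P y) z = poly (?P t + [:s:]) z" if "z \<in> y ` J" for z
        using that y J by (auto simp: poly_prod p_def)
    qed
    then have "poly (?P y) x = poly (?P t + [:s:]) x" for x
      by simp
    then have "(\<Prod>i\<in>J. x - y i) = (\<Prod>i\<in>J. x - t i) + s" for x
      by (simp add: poly_prod)
    moreover have "\<bar>y i - t i\<bar> < \<eta>" if "i \<in> J" for i
      using y[OF that] \<delta>\<eta> by simp
    ultimately show "\<exists>y. (\<forall>i\<in>J. \<bar>y i - t i\<bar> < \<eta>) \<and> (\<forall>x. (\<Prod>i\<in>J. x - y i) = (\<Prod>i\<in>J. x - t i) + s)"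
      by blast
  qed
qed

section \<open>Symmetric polynomials through power sums\<close>

definition power_sum :: "nat \<Rightarrow> real ^ 'n::finite \<Rightarrow> real" where
  "power_sum r x = (\<Sum>i\<in>UNIV. x $ i ^ r)"

text \<open>Up to normalisation, for \<open>A = UNIV\<close>, the symmetrisation of the monomial with exponents \<open>a\<close>.\<close>

definition inj_sum :: "'a set \<Rightarrow> ('a \<Rightarrow> nat) \<Rightarrow> real ^ 'n::finite \<Rightarrow> real" where
  "inj_sum A a x = (\<Sum>f | f \<in> A \<rightarrow>\<^sub>E UNIV \<and> inj_on f A. \<Prod>i\<in>A. (x $ f i) ^ a i)"

text \<open>Let the image of \<open>j\<close> range over all indices and subtract the collisions: if
  \<open>j\<close> and \<open>i\<close> share an image, their exponents merge at
  \<open>i\<close>.\<close>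

lemma inj_sum_insert:
  fixes x :: "real ^ 'n::finite"
  assumes A: "finite A" "j \<notin> A"
  shows "inj_sum (insert j A) a x =
    inj_sum A a x * power_sum (a j) x - (\<Sum>i\<in>A. inj_sum A (a(i := a i + a j)) x)"
proof -
  let ?I = "\<lambda>A. {f :: 'a \<Rightarrow> 'n. f \<in> A \<rightarrow>\<^sub>E UNIV \<and> inj_on f A}"
  let ?w = "\<lambda>f. \<Prod>i\<in>A. (x $ f i) ^ a i"
  have fin: "finite (?I A)"
    using A by (intro finite_subset[OF _ finite_PiE[of A "\<lambda>_. UNIV :: 'n set"]]) auto
  have bij: "bij_betw (\<lambda>(f, l). f(j := l)) (SIGMA f:?I A. - f ` A) (?I (insert j A))"
  proof (rule bij_betw_byWitness[where f' = "\<lambda>f. (restrict f A, f j)"])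
    show "\<forall>b\<in>Sigma (?I A) (\<lambda>f. - f ` A). (\<lambda>f. (restrict f A, f j)) (case b of (f, l) \<Rightarrow> f(j := l)) = b"
      using A by (auto simp: PiE_def extensional_def fun_eq_iff)
    show "\<forall>b\<in>?I (insert j A). (case (restrict b A, b j) of (f, l) \<Rightarrow> f(j := l)) = b"
      by (auto simp: PiE_def extensional_def fun_eq_iff)
    show "(\<lambda>(f, l). f(j := l)) ` Sigma (?I A) (\<lambda>f. - f ` A) \<subseteq> ?I (insert j A)"
    proof clarify
      fix f l assume f: "f \<in> A \<rightarrow>\<^sub>E UNIV" "inj_on f A" "l \<notin> f ` A"
      have "f(j := l) \<in> insert j A \<rightarrow>\<^sub>E UNIV"
        using f(1) by (auto simp: PiE_iff extensional_def)
      moreover have "inj_on (f(j := l)) (insert j A)"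
        using f A by (auto simp: inj_on_insert inj_on_fun_updI fun_upd_image)
      ultimately show "f(j := l) \<in> insert j A \<rightarrow>\<^sub>E UNIV \<and> inj_on (f(j := l)) (insert j A)" ..
    qed
    show "(\<lambda>f. (restrict f A, f j)) ` ?I (insert j A) \<subseteq> Sigma (?I A) (\<lambda>f. - f ` A)"
      using A by (auto simp: inj_on_insert inj_on_restrict_eq)
  qed
  have "inj_sum (insert j A) a x = (\<Sum>(f, l)\<in>(SIGMA f:?I A. - f ` A). ?w f * x $ l ^ a j)"
    unfolding inj_sum_def sum.reindex_bij_betw[OF bij, symmetric]
  proof (rule sum.cong, simp, clarify)
    fix f :: "'a \<Rightarrow> 'n" and l
    have "(\<Prod>i\<in>A. x $ (f(j := l)) i ^ a i) = ?w f"
      using A by (intro prod.cong) auto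
    then show "(\<Prod>i\<in>insert j A. x $ (f(j := l)) i ^ a i) = ?w f * x $ l ^ a j"
      using A by simp
  qed
  also have "\<dots> = (\<Sum>f\<in>?I A. \<Sum>l\<in>- f ` A. ?w f * x $ l ^ a j)"
    using fin by (simp add: sum.Sigma)
  also have "\<dots> = (\<Sum>f\<in>?I A. ?w f * (\<Sum>l\<in>UNIV. x $ l ^ a j) -
      (\<Sum>i\<in>A. \<Prod>i'\<in>A. x $ f i' ^ (a(i := a i + a j)) i'))"
  proof (rule sum.cong, simp)
    fix f assume f: "f \<in> ?I A"
    have "?w f * x $ f i ^ a j = (\<Prod>i'\<in>A. x $ f i' ^ (a(i := a i + a j)) i')" if "i \<in> A" for i
    proof -
      have "(\<Prod>i'\<in>A - {i}. x $ f i' ^ (a(i := a i + a j)) i') = (\<Prod>i'\<in>A - {i}. x $ f i' ^ a i')"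
        by (intro prod.cong) auto
      then show ?thesis
        using A that by (simp add: prod.remove[of A i] power_add)
    qed
    then have 1: "?w f * (\<Sum>l\<in>f ` A. x $ l ^ a j) = (\<Sum>i\<in>A. \<Prod>i'\<in>A. x $ f i' ^ (a(i := a i + a j)) i')"
      using f by (simp add: sum.reindex sum_distrib_left)
    have "(\<Sum>l\<in>UNIV. x $ l ^ a j) = (\<Sum>l\<in>f ` A. x $ l ^ a j) + (\<Sum>l\<in>- f ` A. x $ l ^ a j)"
      using sum.subset_diff[of "f ` A" UNIV "\<lambda>l. x $ l ^ a j"] by (simp add: Compl_eq_Diff_UNIV)
    then show "(\<Sum>l\<in>- f ` A. ?w f * x $ l ^ a j) = ?w f * (\<Sum>l\<in>UNIV. x $ l ^ a j) -
      (\<Sum>i\<in>A. \<Prod>i'\<in>A. x $ f i' ^ (a(i := a i + a j)) i')"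
      unfolding 1[symmetric] by (simp only: sum_distrib_left[symmetric]) (simp add: algebra_simps)
  qed
  also have "\<dots> = inj_sum A a x * power_sum (a j) x - (\<Sum>i\<in>A. inj_sum A (a(i := a i + a j)) x)"
    unfolding inj_sum_def power_sum_def sum_subtractf sum_distrib_right by (subst (2) sum.swap) simp
  finally show ?thesis .
qed

text \<open>Averaging over all permutations does not change \<open>F\<close> and turns each monomial
  into a multiple of an \<open>inj_sum\<close>.\<close>

lemma eval_symmetric_poly:
  fixes F :: "'n::finite rpoly"
  assumes "symmetric_poly F"
  shows "eval_poly F x = (\<Sum>m\<in>Poly_Mapping.keys F.
    Poly_Mapping.lookup F m / fact CARD('n) * inj_sum UNIV (Poly_Mapping.lookup m) x)"
proof -
  let ?S = "{\<sigma>. \<sigma> permutes (UNIV :: 'n set)}"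
  have S: "{f :: 'n \<Rightarrow> 'n. f \<in> UNIV \<rightarrow>\<^sub>E UNIV \<and> inj_on f UNIV} = ?S"
  proof (rule Collect_cong)
    show "f \<in> UNIV \<rightarrow>\<^sub>E UNIV \<and> inj_on f UNIV \<longleftrightarrow> f permutes UNIV" for f :: "'n \<Rightarrow> 'n"
      using inj_imp_permutes[of f UNIV] permutes_inj[of f UNIV] by auto
  qed
  have "fact CARD('n) * eval_poly F x = (\<Sum>\<sigma>\<in>?S. eval_poly F x)"
    by (simp add: card_permutations[OF refl finite])
  also have "\<dots> = (\<Sum>\<sigma>\<in>?S. eval_poly F (\<chi> i. x $ \<sigma> i))"
    using assms by (intro sum.cong) (auto simp: symmetric_poly_def eval_permute_vars[symmetric])
  also have "\<dots> = (\<Sum>m\<in>Poly_Mapping.keys F. Poly_Mapping.lookup F m * inj_sum UNIV (Poly_Mapping.lookup m) x)"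
    unfolding eval_poly_def inj_sum_def S
    by (subst sum.swap) (simp add: sum_distrib_left)
  finally show ?thesis
    by (simp add: field_simps sum_distrib_left flip: sum_divide_distrib)
qed

text \<open>Induction through \<open>inj_sum_insert\<close>. The clause that the slope vanishes for
  total exponent at most \<open>k\<close> is what rules out an \<open>s\<close>-quadratic term in
  the product.\<close>

lemma inj_sum_power_sums:
  fixes y :: "real ^ 'n::finite" and q :: "nat \<Rightarrow> real"
  assumes "finite A" "sum a A \<le> 2 * k + 1" and q: "\<forall>r\<le>k. q r = 0"
  shows "\<exists>c. (sum a A \<le> k \<longrightarrow> c = 0) \<and>
    (\<forall>(z :: real ^ 'n) s. (\<forall>r \<le> 2 * k + 1. power_sum r z = power_sum r y + q r * s) \<longrightarrow>
      inj_sum A a z = inj_sum A a y + c * s)"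
  using assms(1,2)
proof (induction A arbitrary: a)
  case empty
  show ?case by (intro exI[of _ 0]) (simp add: inj_sum_def)
next
  case (insert j A)
  let ?C = "\<lambda>(z :: real ^ 'n) s. \<forall>r \<le> 2 * k + 1. power_sum r z = power_sum r y + q r * s"
  let ?a = "\<lambda>i. a(i := a i + a j)"
  have "\<exists>c. (sum a (insert j A) \<le> k \<longrightarrow> c = 0) \<and>
      (\<forall>z s. ?C z s \<longrightarrow> inj_sum A (?a i) z = inj_sum A (?a i) y + c * s)" if "i \<in> A" for i
  proof -
    have "sum (?a i) (A - {i}) = sum a (A - {i})" by (intro sum.cong) auto
    \<comment> \<open>Merging exponents preserves their total, so the induction hypothesis covers
      the collision terms.\<close>
    then have eq: "sum (?a i) A = sum a (insert j A)"
      using insert.hyps that by (simp add: sum.remove[of A i])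
    then have "sum (?a i) A \<le> 2 * k + 1" using insert.prems by simp
    from insert.IH[OF this] show ?thesis unfolding eq .
  qed
  then obtain c where c: "\<And>i. i \<in> A \<Longrightarrow> sum a (insert j A) \<le> k \<Longrightarrow> c i = 0"
    "\<And>i z s. i \<in> A \<Longrightarrow> ?C z s \<Longrightarrow> inj_sum A (?a i) z = inj_sum A (?a i) y + c i * s"
    by metis
  have "sum a A \<le> 2 * k + 1" using insert.prems insert.hyps by simp
  then obtain b where b: "sum a A \<le> k \<Longrightarrow> b = 0"
    "\<And>z s. ?C z s \<Longrightarrow> inj_sum A a z = inj_sum A a y + b * s"
    using insert.IH[of a] by blast
  have aj: "a j \<le> 2 * k + 1" using insert.prems insert.hyps by simp
  \<comment> \<open>The two degrees add up to at most \<open>2 * k + 1\<close>, so at most one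
    exceeds \<open>k\<close> and at most one factor depends on \<open>s\<close>.\<close>
  have bq: "b = 0 \<or> q (a j) = 0"
  proof (cases "sum a A \<le> k")
    case False
    then have "a j \<le> k" using insert.prems insert.hyps by simp
    then show ?thesis using q by simp
  qed (use b in simp)
  define e where "e = b * power_sum (a j) y + inj_sum A a y * q (a j) - sum c A"
  have "inj_sum (insert j A) a z = inj_sum (insert j A) a y + e * s" if C: "?C z s" for z s
  proof -
    have "(\<Sum>i\<in>A. inj_sum A (?a i) z) = (\<Sum>i\<in>A. inj_sum A (?a i) y) + sum c A * s"
      using c(2)[OF _ C] by (simp add: sum.distrib sum_distrib_right)
    moreover have "power_sum (a j) z = power_sum (a j) y + q (a j) * s"
      using C aj by blast
    ultimately show ?thesis
      unfolding inj_sum_insert[OF insert.hyps] b(2)[OF C] using bq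
      by (auto simp: e_def algebra_simps)
  qed
  moreover have "e = 0" if "sum a (insert j A) \<le> k"
    using that b(1) c(1) q insert.hyps by (simp add: e_def)
  ultimately show ?case by blast
qed

lemma eval_symmetric_poly_power_sums:
  fixes F :: "'n::finite rpoly" and y :: "real ^ 'n" and q :: "nat \<Rightarrow> real"
  assumes "symmetric_poly F" "total_degree F \<le> 2 * k + 1" and q: "\<forall>r\<le>k. q r = 0"
  shows "\<exists>c. \<forall>z s. (\<forall>r \<le> 2 * k + 1. power_sum r z = power_sum r y + q r * s) \<longrightarrow>
      eval_poly F z = eval_poly F y + c * s"
proof -
  let ?C = "\<lambda>(z :: real ^ 'n) s. \<forall>r \<le> 2 * k + 1. power_sum r z = power_sum r y + q r * s"
  let ?M = "\<lambda>m. inj_sum UNIV (Poly_Mapping.lookup m) :: real ^ 'n \<Rightarrow> real"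
  have "\<exists>c. \<forall>z s. ?C z s \<longrightarrow> ?M m z = ?M m y + c * s" if "m \<in> Poly_Mapping.keys F" for m
  proof -
    have "sum (Poly_Mapping.lookup m) UNIV \<le> total_degree F"
      unfolding total_degree_def using that by (intro Max_ge) auto
    then show ?thesis
      using inj_sum_power_sums[of UNIV "Poly_Mapping.lookup m" k q y] assms(2) q by auto
  qed
  then obtain c where c: "\<And>m z s. m \<in> Poly_Mapping.keys F \<Longrightarrow> ?C z s \<Longrightarrow> ?M m z = ?M m y + c m * s"
    by metis
  have "eval_poly F z = eval_poly F y +
      (\<Sum>m\<in>Poly_Mapping.keys F. Poly_Mapping.lookup F m / fact CARD('n) * c m) * s" if "?C z s" for z s
    unfolding eval_symmetric_poly[OF assms(1)] sum_distrib_right sum.distrib[symmetric]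
    by (intro sum.cong refl) (simp add: c[OF _ that] add_divide_distrib distrib_left)
  then show ?thesis by blast
qed

section \<open>Perturbation and minimisation\<close>

text \<open>Only the coordinates in \<open>J\<close> move. From \<open>k < card J\<close>, power
  sums up to \<open>k\<close> are fixed and those up to \<open>2 * k + 1 < 2 * card J\<close> are
  affine in \<open>s\<close>. One slope \<open>c\<close> serves both signs of
  \<open>s\<close>.\<close>

lemma symmetric_poly_perturbation:
  fixes F :: "'n::finite rpoly" and y :: "real ^ 'n"
  assumes F: "symmetric_poly F" "total_degree F \<le> 2 * k + 1"
    and J: "inj_on (($) y) J" "k < card J" and "\<eta> > 0"
  shows "\<exists>\<epsilon>>0. \<exists>c. \<forall>s. \<bar>s\<bar> < \<epsilon> \<longrightarrow> (\<exists>z. (\<forall>i. i \<notin> J \<longrightarrow> z $ i = y $ i) \<and> (\<forall>i. \<bar>z $ i - y $ i\<bar> < \<eta>)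
      \<and> (\<forall>r\<le>k. power_sum r z = power_sum r y) \<and> eval_poly F z = eval_poly F y + c * s
      \<and> (\<forall>x. (\<Prod>i\<in>UNIV. x - z $ i) = (\<Prod>i\<in>UNIV. x - y $ i) + s * (\<Prod>i\<in>-J. x - y $ i)))"
proof -
  have fJ: "finite J" "J \<noteq> {}" using J by auto
  obtain q where q: "\<forall>r<card J. q r = 0"
    "\<forall>u s. (\<forall>x. (\<Prod>i\<in>J. x - u i) = (\<Prod>i\<in>J. x - y $ i) + s) \<longrightarrow>
      (\<forall>r<2 * card J. (\<Sum>i\<in>J. u i ^ r) = (\<Sum>i\<in>J. y $ i ^ r) + q r * s)"
    using power_sum_shift[OF fJ, of "($) y"] by blast
  have q0: "\<forall>r\<le>k. q r = 0" using q(1) J(2) by simp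
  obtain c where c: "\<And>z s. (\<forall>r \<le> 2 * k + 1. power_sum r z = power_sum r y + q r * s) \<Longrightarrow>
      eval_poly F z = eval_poly F y + c * s"
    using eval_symmetric_poly_power_sums[OF F q0, of y] by blast
  obtain \<epsilon> where \<epsilon>: "\<epsilon> > 0" "\<And>s. \<bar>s\<bar> < \<epsilon> \<Longrightarrow>
    \<exists>u. (\<forall>i\<in>J. \<bar>u i - y $ i\<bar> < \<eta>) \<and> (\<forall>x. (\<Prod>i\<in>J. x - u i) = (\<Prod>i\<in>J. x - y $ i) + s)"
    using shifted_prod_roots[OF fJ J(1) \<open>\<eta> > 0\<close>] by blast
  have "\<exists>z. (\<forall>i. i \<notin> J \<longrightarrow> z $ i = y $ i) \<and> (\<forall>i. \<bar>z $ i - y $ i\<bar> < \<eta>)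
      \<and> (\<forall>r\<le>k. power_sum r z = power_sum r y) \<and> eval_poly F z = eval_poly F y + c * s
      \<and> (\<forall>x. (\<Prod>i\<in>UNIV. x - z $ i) = (\<Prod>i\<in>UNIV. x - y $ i) + s * (\<Prod>i\<in>-J. x - y $ i))" if s: "\<bar>s\<bar> < \<epsilon>" for s
  proof -
    obtain u where u: "\<forall>i\<in>J. \<bar>u i - y $ i\<bar> < \<eta>"
      "\<forall>x. (\<Prod>i\<in>J. x - u i) = (\<Prod>i\<in>J. x - y $ i) + s"
      using \<epsilon>(2)[OF s] by blast
    define z :: "real ^ 'n" where "z = (\<chi> i. if i \<in> J then u i else y $ i)"
    have zJ: "\<And>i. i \<in> J \<Longrightarrow> z $ i = u i" and zN: "\<And>i. i \<notin> J \<Longrightarrow> z $ i = y $ i"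
      by (auto simp: z_def)
    have splits: "(\<Sum>i\<in>UNIV. w i) = (\<Sum>i\<in>J. w i) + (\<Sum>i\<in>-J. w i)"
      "(\<Prod>i\<in>UNIV. w i) = (\<Prod>i\<in>J. w i) * (\<Prod>i\<in>-J. w i)" for w :: "'n \<Rightarrow> real"
      using sum.subset_diff[of J UNIV w] prod.subset_diff[of J UNIV w]
      by (simp_all add: Compl_eq_Diff_UNIV)
    have ps: "power_sum r z = power_sum r y + q r * s" if "r \<le> 2 * k + 1" for r
      using q(2)[rule_format, OF u(2)[rule_format], of r] that J(2) by (simp add: power_sum_def splits zJ zN)
    have "(\<Prod>i\<in>UNIV. x - z $ i) = (\<Prod>i\<in>UNIV. x - y $ i) + s * (\<Prod>i\<in>-J. x - y $ i)" for x
      by (simp add: splits zJ zN u(2) algebra_simps)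
    moreover have "\<bar>z $ i - y $ i\<bar> < \<eta>" for i
      using u(1) \<open>\<eta> > 0\<close> by (cases "i \<in> J") (auto simp: zJ zN)
    moreover have "\<forall>r\<le>k. power_sum r z = power_sum r y"
      using ps q0 by simp
    ultimately show ?thesis
      using zN c ps by blast
  qed
  then show ?thesis
    using \<epsilon>(1) by blast
qed

text \<open>Treats both domains at once: \<open>Z\<close> holds the values whose coordinates must
  stay put, empty for the whole space and \<open>{0}\<close> for the orthant.\<close>

lemma minimum_with_few_values:
  fixes F :: "'n::finite rpoly" and C :: "(real ^ 'n) set" and Z :: "real set"
  assumes F: "symmetric_poly F" "total_degree F \<le> 2 * k + 1" and "2 \<le> k"
    and C: "closed C" "x \<in> C"
    and nbhd: "\<And>y. y \<in> C \<Longrightarrow> \<exists>\<eta>>0. \<forall>z. (\<forall>i. \<bar>z $ i - y $ i\<bar> < \<eta>) \<and>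
      (\<forall>i. y $ i \<in> Z \<longrightarrow> z $ i = y $ i) \<longrightarrow> z \<in> C"
  shows "\<exists>y\<in>C. eval_poly F y \<le> eval_poly F x \<and> card {y $ j | j. y $ j \<notin> Z} \<le> k"
proof -
  \<comment> \<open>Since \<open>2 \<le> k\<close>, the sum of squares is prescribed, which makes
    \<open>K\<close> bounded.\<close>
  define K where "K = C \<inter> (\<Inter>r\<in>{..k}. {y. power_sum r y = power_sum r x})"
  have norm: "\<bar>y $ i\<bar> \<le> sqrt (power_sum 2 x)" if "y \<in> K" for y i
  proof -
    have "(y $ i)\<^sup>2 \<le> power_sum 2 y"
      unfolding power_sum_def by (rule member_le_sum) auto
    then show ?thesis
      using that \<open>2 \<le> k\<close> by (simp add: K_def real_le_rsqrt)
  qed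
  have "closed {y. power_sum r y = power_sum r x}" for r
    unfolding power_sum_def by (intro closed_Collect_eq continuous_intros)
  then have "closed K"
    unfolding K_def using C(1) by (intro closed_Int closed_INT) auto
  moreover have "norm y \<le> (\<Sum>i\<in>(UNIV :: 'n set). sqrt (power_sum 2 x))" if "y \<in> K" for y
    by (rule order_trans[OF norm_le_l1_cart]) (intro sum_mono norm that)
  then have "bounded K" unfolding bounded_iff by blast
  ultimately have K: "compact K" by (simp add: compact_eq_bounded_closed)
  have cF: "continuous_on S (eval_poly F)" for S
    unfolding eval_poly_def by (intro continuous_intros)
  have "x \<in> K" using C by (simp add: K_def)
  then obtain y0 where y0: "y0 \<in> K" "\<And>z. z \<in> K \<Longrightarrow> eval_poly F y0 \<le> eval_poly F z"
    using continuous_attains_inf[OF K _ cF] by blast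
  define M where "M = K \<inter> {z. eval_poly F z = eval_poly F y0}"
  have "compact M"
    unfolding M_def by (intro compact_Int_closed K closed_Collect_eq cF continuous_on_const)
  \<comment> \<open>Larger than every coordinate of every point of \<open>K\<close>, so all factors
    of \<open>V\<close> are positive there.\<close>
  define t where "t = sqrt (power_sum 2 x) + 1"
  define V where "V = (\<lambda>z :: real ^ 'n. \<Prod>i\<in>UNIV. t - z $ i)"
  have cV: "continuous_on M V" unfolding V_def by (intro continuous_intros)
  have "y0 \<in> M" using y0 by (simp add: M_def)
  then obtain y where y: "y \<in> M" "\<And>z. z \<in> M \<Longrightarrow> V z \<le> V y"
    using continuous_attains_sup[OF \<open>compact M\<close> _ cV] by blast
  have yK: "y \<in> K" and yF: "eval_poly F y = eval_poly F y0" using y by (auto simp: M_def)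
  have "card {y $ j | j. y $ j \<notin> Z} \<le> k"
  proof (rule ccontr)
    let ?N = "{j. y $ j \<notin> Z}"
    assume many: "\<not> ?thesis"
    \<comment> \<open>One coordinate for each value outside \<open>Z\<close>.\<close>
    obtain J where J: "J \<subseteq> ?N" "inj_on (($) y) J" "($) y ` ?N = ($) y ` J"
      using subset_image_inj[of "($) y ` ?N" "($) y" ?N] by blast
    have "{y $ j | j. y $ j \<notin> Z} = ($) y ` ?N" by auto
    then have "k < card J" using many J(2,3) by (simp add: card_image)
    obtain \<eta> where \<eta>: "\<eta> > 0" "\<And>z. (\<forall>i. \<bar>z $ i - y $ i\<bar> < \<eta>) \<Longrightarrow>
        (\<forall>i. y $ i \<in> Z \<longrightarrow> z $ i = y $ i) \<Longrightarrow> z \<in> C"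
      using nbhd[of y] yK by (auto simp: K_def)
    obtain \<epsilon> c where \<epsilon>: "\<epsilon> > 0"
      "\<And>s. \<bar>s\<bar> < \<epsilon> \<Longrightarrow> \<exists>z. (\<forall>i. i \<notin> J \<longrightarrow> z $ i = y $ i) \<and> (\<forall>i. \<bar>z $ i - y $ i\<bar> < \<eta>)
      \<and> (\<forall>r\<le>k. power_sum r z = power_sum r y) \<and> eval_poly F z = eval_poly F y + c * s
      \<and> (\<forall>x. (\<Prod>i\<in>UNIV. x - z $ i) = (\<Prod>i\<in>UNIV. x - y $ i) + s * (\<Prod>i\<in>-J. x - y $ i))"
      using symmetric_poly_perturbation[OF F J(2) \<open>k < card J\<close> \<eta>(1)] by blast
    have z: "\<exists>z\<in>K. eval_poly F z = eval_poly F y + c * s \<and> V z = V y + s * (\<Prod>i\<in>-J. t - y $ i)"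
      if "\<bar>s\<bar> < \<epsilon>" for s
    proof -
      obtain z where z: "\<forall>i. i \<notin> J \<longrightarrow> z $ i = y $ i" "\<forall>i. \<bar>z $ i - y $ i\<bar> < \<eta>"
        "\<forall>r\<le>k. power_sum r z = power_sum r y" "eval_poly F z = eval_poly F y + c * s"
        "\<forall>x. (\<Prod>i\<in>UNIV. x - z $ i) = (\<Prod>i\<in>UNIV. x - y $ i) + s * (\<Prod>i\<in>-J. x - y $ i)"
        using \<epsilon>(2)[OF \<open>\<bar>s\<bar> < \<epsilon>\<close>] by blast
      have "z \<in> C" using \<eta>(2)[of z] z(1,2) J(1) by blast
      then have "z \<in> K" using z(3) yK by (simp add: K_def)
      then show ?thesis using z(4,5) by (auto simp: V_def)
    qed
    have sl: "0 \<le> c * s" if "\<bar>s\<bar> < \<epsilon>" for s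
      using z[OF that] y0(2) yF by force
    \<comment> \<open>Minimality at \<open>y\<close> forbids a nonzero slope, as \<open>s\<close>
      may have either sign.\<close>
    have "c = 0"
      using sl[of "\<epsilon> / 2"] sl[of "- (\<epsilon> / 2)"] \<epsilon>(1) by (auto simp: zero_le_mult_iff mult_le_0_iff)
    \<comment> \<open>With slope zero the perturbed point is again a minimiser, yet a positive
      \<open>s\<close> makes \<open>V\<close> larger than its maximum.\<close>
    then obtain z where "z \<in> M" "V z = V y + \<epsilon> / 2 * (\<Prod>i\<in>-J. t - y $ i)"
      using z[of "\<epsilon> / 2"] \<epsilon>(1) yF by (auto simp: M_def)
    moreover have "(\<Prod>i\<in>-J. t - y $ i) > 0"
    proof (rule prod_pos)
      show "0 < t - y $ i" for i using norm[OF yK, of i] by (simp add: t_def)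
    qed
    ultimately show False using y(2)[of z] \<epsilon>(1) by (simp add: mult_le_0_iff)
  qed
  moreover have "y \<in> C" using yK by (simp add: K_def)
  moreover have "eval_poly F y \<le> eval_poly F x" using yF y0(2)[OF \<open>x \<in> K\<close>] by simp
  ultimately show ?thesis by blast
qed

theorem theorem1p3:
  fixes F :: "'n::finite rpoly" and d k :: nat
  assumes "symmetric_poly F"
    and "total_degree F = d"
    and "k = max 2 (d div 2)"
  shows "((\<forall>x :: real ^ 'n. eval_poly F x \<ge> 0) \<longleftrightarrow>
            (\<forall>x \<in> (A_set k :: (real ^ 'n) set). eval_poly F x \<ge> 0))
       \<and> ((\<forall>x \<in> (nonneg_orthant :: (real ^ 'n) set). eval_poly F x \<ge> 0) \<longleftrightarrow>
            (\<forall>x \<in> (A_plus_set k :: (real ^ 'n) set). eval_poly F x \<ge> 0))"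
proof -
  \<comment> \<open>Halving rounds down, so \<open>d\<close> is at most
    \<open>2 * (d div 2) + 1\<close>.\<close>
  have k: "total_degree F \<le> 2 * k + 1" "2 \<le> k"
    using assms(2,3) by auto
  have 1: "\<exists>y\<in>A_set k. eval_poly F y \<le> eval_poly F x" for x :: "real ^ 'n"
  proof -
    have "\<exists>y\<in>UNIV. eval_poly F y \<le> eval_poly F x \<and> card {y $ j | j. y $ j \<notin> {}} \<le> k"
      by (rule minimum_with_few_values[OF assms(1) k closed_UNIV UNIV_I]) (auto intro: exI[of _ 1])
    then show ?thesis by (auto simp: A_set_def num_distinct_def)
  qed
  have 2: "\<exists>y\<in>A_plus_set k. eval_poly F y \<le> eval_poly F x" if x: "x \<in> nonneg_orthant" for x :: "real ^ 'n"
  proof -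
    have cl: "closed (nonneg_orthant :: (real ^ 'n) set)"
      unfolding nonneg_orthant_def by (intro closed_Collect_all closed_Collect_le continuous_intros)
    have "\<exists>\<eta>>0. \<forall>z. (\<forall>i. \<bar>z $ i - y $ i\<bar> < \<eta>) \<and> (\<forall>i. y $ i \<in> {0} \<longrightarrow> z $ i = y $ i) \<longrightarrow>
        z \<in> nonneg_orthant" if "y \<in> nonneg_orthant" for y :: "real ^ 'n"
    proof -
      \<comment> \<open>Zero coordinates stay fixed and the others are at least
        \<open>Min D\<close>, so moves below \<open>Min D\<close> keep them nonnegative. The element
        1 covers \<open>y = 0\<close>.\<close>
      define D where "D = insert 1 (($) y ` {i. y $ i \<noteq> 0})"
      have D: "finite D" "\<forall>a\<in>D. a > 0"
        using that by (auto simp: D_def nonneg_orthant_def less_le)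
      have "z \<in> nonneg_orthant"
        if z: "\<And>i. \<bar>z $ i - y $ i\<bar> < Min D" "\<And>i. y $ i = 0 \<Longrightarrow> z $ i = y $ i" for z
        unfolding nonneg_orthant_def
      proof (intro CollectI allI)
        fix i
        show "0 \<le> z $ i"
        proof (cases "y $ i = 0")
          case False
          then have "Min D \<le> y $ i" using D(1) by (intro Min_le) (auto simp: D_def)
          then show ?thesis using z(1)[of i] by linarith
        qed (use z in auto)
      qed
      moreover have "Min D > 0" using D by (subst Min_gr_iff) (auto simp: D_def)
      ultimately show ?thesis by (metis singletonI)
    qed
    then have "\<exists>y\<in>nonneg_orthant. eval_poly F y \<le> eval_poly F x \<and> card {y $ j | j. y $ j \<notin> {0}} \<le> k"
      by (rule minimum_with_few_values[OF assms(1) k cl x])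
    then show ?thesis by (auto simp: A_plus_set_def num_distinct_nonzero_def)
  qed
  have "A_plus_set k \<subseteq> (nonneg_orthant :: (real ^ 'n) set)"
    by (auto simp: A_plus_set_def)
  then show ?thesis using 1 2 by (meson order_trans subsetD)
qed

end
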